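(* Let $S$ be a numerical monoid and let $H\subset\mathcal P_{\mathrm{fin},0}(S)$ be a divisor-closed submonoid with $H\ne\{\{0\}\}$. Then $H$ is neither torsion-free nor locally finitely generated. Moreover, there is no transfer homomorphism $\varphi\colon H\to B$ where $B$ is a cancellative monoid. In particular, $H$ is not transfer Krull.
   Context: A numerical monoid is an additive submonoid of $\mathbb N_0$ with $\gcd 1$. $\mathcal P_{\mathrm{fin},0}(S)$ is the monoid of finite subsets of $S$ containing $0$ under set addition (identity $\{0\}$, its only unit). All monoids here are commutative semigroups with identity that are unit-cancellative ($a=a+u$ implies $u$ invertible); $H^\times$ denotes the group of units. $a$ divides $b$ in $H$ if $b=a+c$ for some $c\in H$; a submonoid is divisor-closed if it contains all divisors of its elements; $[\![a]\!]$ is the set of elements dividing some multiple $na$, $n\in\mathbb N_0$. $H$ is torsion-free if $na=nb$ with $a,b\in H$, $n\in\mathbb N$ implies $a=b$. $H$ is locally finitely generated if $[\![a]\!]_{\mathrm{red}}=[\![a]\!]/H^\times$ is finitely generated for every $a\in H$. A monoid is cancellative if $a+b=a+c$ implies $b=c$. A monoid homomorphism $\theta\colon H\to B$ is a transfer homomorphism if (T1) $B=\theta(H)+B^\times$ and $\theta^{-1}(B^\times)=H^\times$, and (T2) whenever $u\in H$, $b,c\in B$ and $\theta(u)=b+c$, there exist $v,w\in H$ with $u=v+w$, $\theta(v)\in b+B^\times$ and $\theta(w)\in c+B^\times$. A Krull monoid is a cancellative, completely integrally closed monoid satisfying the ascending chain condition on divisorial ideals; a monoid is transfer Krull if it admits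 a transfer homomorphism to a Krull monoid. *)

theory Defs
  imports
    "HOL-Library.Set_Algebras"
    "HOL-Algebra.Coset"
    "HOL-Algebra.Divisibility"
begin

text \<open>
  Abstract monoids are commutative monoids in the record format of HOL-Algebra, hence written
  multiplicatively: \<open>a + b\<close> becomes \<open>a \<otimes> b\<close>, the multiple \<open>n a\<close> becomes \<open>a [^] n\<close>, and \<open>H\<^sup>\<times>\<close>
  becomes \<open>Units H\<close>. A submonoid \<open>N\<close> of \<open>M\<close>, regarded as a monoid of its own, is
  \<open>M\<lparr>carrier := N\<rparr>\<close>.
\<close>

section \<open>Numerical monoids and power monoids\<close>

definition numerical_monoid :: "nat set \<Rightarrow> bool" where
  "numerical_monoid S \<longleftrightarrow> 0 \<in> S \<and> (\<forall>a\<in>S. \<forall>b\<in>S. a + b \<in> S) \<and> Gcd S = 1"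

text \<open>Here \<open>+\<close> on sets is the sumset \<open>A + B = {a + b | a \<in> A, b \<in> B}\<close>.\<close>

definition Pfin0 :: "nat set \<Rightarrow> nat set monoid" where
  "Pfin0 S = \<lparr>carrier = {A. finite A \<and> A \<subseteq> S \<and> 0 \<in> A}, mult = (+), one = {0}\<rparr>"


section \<open>Divisor-closed submonoids and local finite generation\<close>

definition divisor_closed_submonoid :: "'a set \<Rightarrow> ('a, 'c) monoid_scheme \<Rightarrow> bool" where
  "divisor_closed_submonoid N M \<longleftrightarrow>
     submonoid N M \<and> (\<forall>b\<in>N. \<forall>a\<in>carrier M. a divides\<^bsub>M\<^esub> b \<longrightarrow> a \<in> N)"

definition torsion_free :: "('a, 'c) monoid_scheme \<Rightarrow> bool" where
  "torsion_free M \<longleftrightarrow>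
     (\<forall>a\<in>carrier M. \<forall>b\<in>carrier M. \<forall>n::nat. n \<ge> 1 \<longrightarrow> a [^]\<^bsub>M\<^esub> n = b [^]\<^bsub>M\<^esub> n \<longrightarrow> a = b)"

definition divisor_closure :: "('a, 'c) monoid_scheme \<Rightarrow> 'a \<Rightarrow> 'a set" where
  "divisor_closure M a = {b \<in> carrier M. \<exists>n::nat. b divides\<^bsub>M\<^esub> (a [^]\<^bsub>M\<^esub> n)}"

definition reduced_monoid :: "('a, 'c) monoid_scheme \<Rightarrow> 'a set monoid" where
  "reduced_monoid M =
     \<lparr>carrier = (\<lambda>a. a <#\<^bsub>M\<^esub> Units M) ` carrier M, mult = set_mult M, one = Units M\<rparr>"

definition finitely_generated_monoid :: "('a, 'c) monoid_scheme \<Rightarrow> bool" where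
  "finitely_generated_monoid M \<longleftrightarrow>
     (\<exists>E. finite E \<and> E \<subseteq> carrier M \<and> carrier M = \<Inter> {N. submonoid N M \<and> E \<subseteq> N})"

definition locally_finitely_generated :: "('a, 'c) monoid_scheme \<Rightarrow> bool" where
  "locally_finitely_generated M \<longleftrightarrow>
     (\<forall>a\<in>carrier M.
        finitely_generated_monoid (reduced_monoid (M\<lparr>carrier := divisor_closure M a\<rparr>)))"


section \<open>Transfer homomorphisms\<close>

text \<open>
  The set \<open>hom H B\<close> does not require preservation of the identity, which is part of the notion
  of a monoid homomorphism.
\<close>

definition transfer_hom ::
  "('a, 'c) monoid_scheme \<Rightarrow> ('b, 'd) monoid_scheme \<Rightarrow> ('a \<Rightarrow> 'b) \<Rightarrow> bool" where
  "transfer_hom H B \<theta> \<longleftrightarrow>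
     \<theta> \<in> hom H B \<and> \<theta> \<one>\<^bsub>H\<^esub> = \<one>\<^bsub>B\<^esub> \<and>
     carrier B = (\<theta> ` carrier H) <#>\<^bsub>B\<^esub> Units B \<and>
     {u \<in> carrier H. \<theta> u \<in> Units B} = Units H \<and>
     (\<forall>u\<in>carrier H. \<forall>b\<in>carrier B. \<forall>c\<in>carrier B. \<theta> u = b \<otimes>\<^bsub>B\<^esub> c \<longrightarrow>
        (\<exists>v\<in>carrier H. \<exists>w\<in>carrier H.
           u = v \<otimes>\<^bsub>H\<^esub> w \<and> \<theta> v \<in> b <#\<^bsub>B\<^esub> Units B \<and> \<theta> w \<in> c <#\<^bsub>B\<^esub> Units B))"


section \<open>Krull monoids\<close>

text \<open>
  The quotient group \<open>q(M)\<close> of a cancellative commutative monoid consists of the fractions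
  \<open>a / b\<close>, where \<open>a / b = c / d\<close> iff \<open>a d = c b\<close>. All definitions in this section are
  meant for cancellative \<open>M\<close>, and \<open>krull_monoid\<close> assumes this.
\<close>

definition frac_rel :: "('a, 'c) monoid_scheme \<Rightarrow> (('a \<times> 'a) \<times> ('a \<times> 'a)) set" where
  "frac_rel M = {((a, b), (c, d)). a \<in> carrier M \<and> b \<in> carrier M \<and> c \<in> carrier M \<and>
     d \<in> carrier M \<and> a \<otimes>\<^bsub>M\<^esub> d = c \<otimes>\<^bsub>M\<^esub> b}"

definition frac :: "('a, 'c) monoid_scheme \<Rightarrow> 'a \<Rightarrow> 'a \<Rightarrow> ('a \<times> 'a) set" where
  "frac M a b = frac_rel M `` {(a, b)}"

definition quotient_group :: "('a, 'c) monoid_scheme \<Rightarrow> ('a \<times> 'a) set monoid" where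
  "quotient_group M =
     \<lparr>carrier = (carrier M \<times> carrier M) // frac_rel M,
      mult = (\<lambda>X Y. \<Union>(a, b)\<in>X. \<Union>(c, d)\<in>Y. frac M (a \<otimes>\<^bsub>M\<^esub> c) (b \<otimes>\<^bsub>M\<^esub> d)),
      one = frac M \<one>\<^bsub>M\<^esub> \<one>\<^bsub>M\<^esub>\<rparr>"

definition into_quotient :: "('a, 'c) monoid_scheme \<Rightarrow> 'a \<Rightarrow> ('a \<times> 'a) set" where
  "into_quotient M a = frac M a \<one>\<^bsub>M\<^esub>"

definition completely_integrally_closed :: "('a, 'c) monoid_scheme \<Rightarrow> bool" where
  "completely_integrally_closed M \<longleftrightarrow>
     (\<forall>x\<in>carrier (quotient_group M).
        (\<exists>c\<in>carrier M. \<forall>n::nat.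
           into_quotient M c \<otimes>\<^bsub>quotient_group M\<^esub> (x [^]\<^bsub>quotient_group M\<^esub> n)
             \<in> into_quotient M ` carrier M) \<longrightarrow>
        x \<in> into_quotient M ` carrier M)"

text \<open>
  For \<open>X \<subseteq> q(M)\<close>, \<open>inverse_ideal M X\<close> is \<open>X\<^sup>-\<^sup>1 = (M : X) = {x \<in> q(M) | x X \<subseteq> M}\<close>, and an ideal
  \<open>I\<close> of \<open>M\<close> is divisorial if \<open>I\<close> equals \<open>I\<^sub>v = (I\<^sup>-\<^sup>1)\<^sup>-\<^sup>1\<close>.
\<close>

definition inverse_ideal ::
  "('a, 'c) monoid_scheme \<Rightarrow> ('a \<times> 'a) set set \<Rightarrow> ('a \<times> 'a) set set" where
  "inverse_ideal M X = {x \<in> carrier (quotient_group M).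
     \<forall>y\<in>X. x \<otimes>\<^bsub>quotient_group M\<^esub> y \<in> into_quotient M ` carrier M}"

definition divisorial_ideal :: "'a set \<Rightarrow> ('a, 'c) monoid_scheme \<Rightarrow> bool" where
  "divisorial_ideal I M \<longleftrightarrow>
     I \<subseteq> carrier M \<and>
     inverse_ideal M (inverse_ideal M (into_quotient M ` I)) = into_quotient M ` I"

definition acc_divisorial_ideals :: "('a, 'c) monoid_scheme \<Rightarrow> bool" where
  "acc_divisorial_ideals M \<longleftrightarrow>
     (\<forall>I :: nat \<Rightarrow> 'a set.
        (\<forall>n. divisorial_ideal (I n) M \<and> I n \<subseteq> I (Suc n)) \<longrightarrow> (\<exists>N. \<forall>n\<ge>N. I n = I N))"

definition krull_monoid :: "('a, 'c) monoid_scheme \<Rightarrow> bool" where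
  "krull_monoid M \<longleftrightarrow>
     comm_monoid_cancel M \<and> completely_integrally_closed M \<and> acc_divisorial_ideals M"

text \<open>
  HOL cannot quantify over types inside a formula, so the type \<open>'b\<close> in which the Krull monoid
  lives is a parameter. Results with \<open>'b\<close> as a type variable hold for Krull monoids over every
  type.
\<close>

definition transfer_krull :: "'b itself \<Rightarrow> ('a, 'c) monoid_scheme \<Rightarrow> bool" where
  "transfer_krull (_ :: 'b itself) H \<longleftrightarrow>
     (\<exists>(B :: 'b monoid) \<theta>. krull_monoid B \<and> transfer_hom H B \<theta>)"

end

theory Submission
  imports Defs
begin

text \<open>
  If \<open>A \<in> H\<close> has maximum \<open>a > 0\<close>, then a zero-sum argument modulo \<open>a\<close> shows
  \<open>a A = {0, a} + (a - 1) A\<close>, so that \<open>J = {0, a}\<close> lies in \<open>H\<close>. Its multiples are the sets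
  \<open>n J = a [0, n]\<close>. As \<open>{0, n a} + n J = 2 n J\<close>, all the atoms \<open>{0, n a}\<close> divide multiples of
  \<open>J\<close>, whence \<open>H\<close> is not locally finitely generated. It is not torsion-free because
  \<open>2 {0, a, 3 a, 4 a} = 2 (4 J)\<close>. Finally \<open>{0, 2 a} + J = 3 J\<close> forces a homomorphism to a
  cancellative monoid to send the atom \<open>{0, 2 a}\<close> to twice the image of the non-unit \<open>J\<close>, which
  no transfer homomorphism does.
\<close>

section \<open>Sumsets of sets of natural numbers\<close>

text \<open>This makes \<open>{0, c}\<close> with \<open>c > 0\<close> an atom. Both summands lie
  inside the sumset, so if neither is trivial, both contain \<open>c\<close>, and
  \<open>c + c\<close> would have to be \<open>0\<close> or \<open>c\<close>.\<close>

lemma two_point_sumset: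
  fixes X Y :: "nat set"
  assumes "X + Y = {0, c}" "0 \<in> X" "0 \<in> Y"
  shows "X = {0} \<or> Y = {0}"
proof (rule ccontr)
  assume neg: "\<not> (X = {0} \<or> Y = {0})"
  have "X \<subseteq> {0, c}" "Y \<subseteq> {0, c}"
    using assms set_plus_intro[of _ X 0 Y] set_plus_intro[of 0 X _ Y] by auto
  with neg assms(2,3) have "c \<in> X" "c \<in> Y" "c \<noteq> 0"
    by auto
  then have "c + c \<in> {0, c}"
    using assms(1) set_plus_intro by blast
  with \<open>c \<noteq> 0\<close> show False
    by auto
qed

lemma sumset_eq_zeroD:
  fixes X Y :: "nat set"
  assumes "X + Y = {0}"
  shows "X = {0}"
proof -
  obtain x y where "x \<in> X" "y \<in> Y"
    using assms by (metis insertI1 set_plus_elim)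
  moreover have "x' + y' = 0" if "x' \<in> X" "y' \<in> Y" for x' y'
    using assms that set_plus_intro by blast
  ultimately show ?thesis
    by auto
qed

lemma interval_sumset: "{..m} + {..n} = {..m + n :: nat}"
proof
  show "{..m + n} \<subseteq> {..m} + {..n}"
  proof
    fix x assume "x \<in> {..m + n}"
    \<comment> \<open>The first summand is filled up to \<open>m\<close> and the second takes the
      rest, which truncated subtraction makes \<open>0\<close> when \<open>x\<close> is at most
      \<open>m\<close>.\<close>
    then have "min x m + (x - m) \<in> {..m} + {..n}"
      by (intro set_plus_intro) auto
    then show "x \<in> {..m} + {..n}"
      by (simp add: min_def split: if_splits)
  qed
qed (auto elim!: set_plus_elim)

lemma end_points_sumset: "{0, n} + {..n} = {..n + n :: nat}"
proof
  show "{..n + n} \<subseteq> {0, n} + {..n}"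
  proof
    fix x assume x: "x \<in> {..n + n}"
    show "x \<in> {0, n} + {..n}"
    proof (cases "x \<le> n")
      case True
      then show ?thesis
        using set_plus_intro[of 0 "{0, n}" x "{..n}"] by simp
    next
      case False
      then show ?thesis
        using x set_plus_intro[of n "{0, n}" "x - n" "{..n}"] by simp
    qed
  qed
qed (auto elim!: set_plus_elim)

lemma image_mult_sumset: "(*) a ` (X + Y) = (*) a ` X + (*) (a :: nat) ` Y"
proof
  show "(*) a ` (X + Y) \<subseteq> (*) a ` X + (*) a ` Y"
    by (auto elim!: set_plus_elim simp: distrib_left intro!: set_plus_intro)
  show "(*) a ` X + (*) a ` Y \<subseteq> (*) a ` (X + Y)"
    by (auto elim!: set_plus_elim simp flip: distrib_left)
qed

lemma sum_two_point: "(\<Sum>i<n. {0, a}) = (*) (a :: nat) ` {..n}"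
proof (induction n)
  case (Suc n)
  have "{0, a} = (*) a ` {..Suc 0}"
    by (auto simp: atMost_Suc)
  with Suc show ?case
    by (simp add: image_mult_sumset[symmetric] interval_sumset)
qed simp

text \<open>Since \<open>0\<close> lies in \<open>A\<close>, fewer than \<open>n\<close> summands
  can be padded with zeros. An arbitrary index set is allowed so that a single index can be deleted
  from a range.\<close>

lemma sum_mem_multiple:
  assumes "finite I" "card I \<le> n" "0 \<in> A" "\<And>i. i \<in> I \<Longrightarrow> f i \<in> A"
  shows "(\<Sum>i\<in>I. f i) \<in> (\<Sum>i<n. A :: nat set)"
proof -
  obtain h where h: "bij_betw h I {..<card I}"
    using assms(1) ex_bij_betw_finite_nat[of I] by (auto simp: atLeast0LessThan)
  define g where "g i = (if i < card I then f (inv_into I h i) else 0)" for i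
  have "bij_betw (inv_into I h) {..<card I} I"
    using h by (rule bij_betw_inv_into)
  then have "(\<Sum>i\<in>I. f i) = (\<Sum>i<card I. g i)"
    by (simp add: g_def sum.reindex_bij_betw)
  also have "\<dots> = (\<Sum>i<n. g i)"
    using assms(2) by (intro sum.mono_neutral_left) (auto simp: g_def)
  finally have "(\<Sum>i\<in>I. f i) = (\<Sum>i<n. g i)" .
  moreover have "\<forall>i\<in>{..<n}. g i \<in> A"
    using assms(3,4) \<open>bij_betw (inv_into I h) {..<card I} I\<close>
    by (auto simp: g_def bij_betw_def)
  ultimately show ?thesis
    by (subst set_sum_alt) auto
qed

text \<open>For the nontrivial inclusion, two of the \<open>a + 1\<close> partial sums of
  \<open>a\<close> elements agree modulo \<open>a\<close>. The block of summands between them adds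
  up to a multiple of \<open>a\<close> and can be rewritten with entries \<open>a\<close> and
  \<open>0\<close> only; one such entry is then split off.\<close>

lemma multiple_eq_two_point_plus:
  fixes A :: "nat set"
  assumes A: "0 \<in> A" "a \<in> A" "\<And>x. x \<in> A \<Longrightarrow> x \<le> a" and a: "a > 0"
  shows "(\<Sum>i<a. A) = {0, a} + (\<Sum>i<a - 1. A)"
proof
  have "(\<Sum>i<a. A) = A + (\<Sum>i<a - 1. A)"
    using a by (cases a) (simp_all add: add.commute)
  then show "{0, a} + (\<Sum>i<a - 1. A) \<subseteq> (\<Sum>i<a. A)"
    using A by (simp add: set_plus_mono2)
  show "(\<Sum>i<a. A) \<subseteq> {0, a} + (\<Sum>i<a - 1. A)"
  proof
    fix x assume "x \<in> (\<Sum>i<a. A)"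
    then obtain f where f: "x = (\<Sum>i<a. f i)" "\<And>i. i < a \<Longrightarrow> f i \<in> A"
      by (subst (asm) set_sum_alt) auto
    define p where "p j = (\<Sum>i<j. f i) mod a" for j
    have "p ` {..a} \<subseteq> {..<a}"
      using a by (auto simp: p_def)
    then have "card (p ` {..a}) \<le> a"
      using card_mono[of "{..<a}" "p ` {..a}"] by simp
    then have "\<not> inj_on p {..a}"
      by (intro pigeonhole) simp
    then obtain i j where ij: "i < j" "j \<le> a" "p i = p j"
      unfolding inj_on_def by (metis atMost_iff linorder_neqE_nat)
    have split_j: "(\<Sum>l<j. f l) = (\<Sum>l<i. f l) + (\<Sum>l\<in>{i..<j}. f l)"
      using ij(1) sum.atLeastLessThan_concat[of 0 i j f] by (simp add: atLeast0LessThan)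
    \<comment> \<open>By \<open>split_j\<close> this subtraction is not truncated, so equal residues
      make the block sum divisible by \<open>a\<close>.\<close>
    have "a dvd (\<Sum>l<j. f l) - (\<Sum>l<i. f l)"
      using ij(3) unfolding p_def by (intro mod_eq_dvd_iff_nat[THEN iffD1]) (auto simp: split_j)
    then obtain k where k: "(\<Sum>l\<in>{i..<j}. f l) = a * k"
      by (auto simp: split_j)
    have "(\<Sum>l\<in>{i..<j}. f l) \<le> (\<Sum>l\<in>{i..<j}. a)"
      using ij A(3) f(2) by (intro sum_mono) auto
    then have "k \<le> j - i"
      using k a by (simp add: mult.commute)
    \<comment> \<open>Replace the summands with index in \<open>{i..<j}\<close> by \<open>k\<close> copies of \<open>a\<close>, padded with zeros.\<close>
    define g where "g l = (if l < i \<or> j \<le> l then f l else if l < i + k then a else 0)" for l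
    have sum_parts: "(\<Sum>l<a. h l) = (\<Sum>l\<in>{..<a} - {i..<j}. h l) + (\<Sum>l\<in>{i..<j}. h l)"
      for h :: "nat \<Rightarrow> nat"
      using ij by (intro sum.subset_diff) auto
    have "(\<Sum>l\<in>{i..<j}. g l) = (\<Sum>l\<in>{i..<i + k}. a)"
      using \<open>k \<le> j - i\<close> ij by (intro sum.mono_neutral_cong_right) (auto simp: g_def)
    moreover have "(\<Sum>l\<in>{..<a} - {i..<j}. g l) = (\<Sum>l\<in>{..<a} - {i..<j}. f l)"
      by (intro sum.cong) (auto simp: g_def)
    ultimately have "x = (\<Sum>l<a. g l)"
      using k f(1) sum_parts[of f] sum_parts[of g] by (simp add: mult.commute)
    \<comment> \<open>Index \<open>i\<close> opens the block, so \<open>g i\<close> is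
      \<open>a\<close> if \<open>k > 0\<close> and \<open>0\<close> otherwise. The other
      \<open>a - 1\<close> entries stay in \<open>A\<close>.\<close>
    also have "\<dots> = g i + (\<Sum>l\<in>{..<a} - {i}. g l)"
      using ij by (intro sum.remove) auto
    also have "\<dots> \<in> {0, a} + (\<Sum>i<a - 1. A)"
    proof (intro set_plus_intro sum_mem_multiple)
      show "g i \<in> {0, a}"
        using ij by (auto simp: g_def)
      show "card ({..<a} - {i}) \<le> a - 1"
        using ij by simp
      show "g l \<in> A" if "l \<in> {..<a} - {i}" for l
        using that A f(2) by (auto simp: g_def)
    qed (use A in auto)
    finally show "x \<in> {0, a} + (\<Sum>i<a - 1. A)" .
  qed
qed

section \<open>Divisor-closed submonoids of the power monoid\<close>

lemma Pfin0_simps: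
  "X \<in> carrier (Pfin0 S) \<longleftrightarrow> finite X \<and> X \<subseteq> S \<and> 0 \<in> X"
  "X \<otimes>\<^bsub>Pfin0 S\<^esub> Y = X + Y"
  "\<one>\<^bsub>Pfin0 S\<^esub> = {0}"
  by (simp_all add: Pfin0_def)

lemma pow_Pfin0: "X [^]\<^bsub>(Pfin0 S)\<lparr>carrier := N\<rparr>\<^esub> (n :: nat) = (\<Sum>i<n. X)"
  by (induction n) (simp_all add: nat_pow_def Pfin0_simps)

locale divisor_closed_power_monoid =
  fixes S :: "nat set" and H :: "nat set set"
  assumes H: "divisor_closed_submonoid H (Pfin0 S)"
    and nontrivial: "H \<noteq> {{0}}"
begin

abbreviation M :: "nat set monoid" where
  "M \<equiv> (Pfin0 S)\<lparr>carrier := H\<rparr>"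

lemma zero_mem: "{0} \<in> H"
  using H submonoid.one_closed by (fastforce simp: divisor_closed_submonoid_def Pfin0_simps)

lemma memD: "X \<in> H \<Longrightarrow> finite X \<and> X \<subseteq> S \<and> 0 \<in> X"
  using H submonoid.mem_carrier[of H "Pfin0 S" X]
  by (simp add: divisor_closed_submonoid_def Pfin0_simps)

lemma add_mem: "X \<in> H \<Longrightarrow> Y \<in> H \<Longrightarrow> X + Y \<in> H"
  using H submonoid.m_closed[of H "Pfin0 S" X Y]
  by (simp add: divisor_closed_submonoid_def Pfin0_simps)

lemma sum_mem: "X \<in> H \<Longrightarrow> (\<Sum>i<n :: nat. X) \<in> H"
  by (induction n) (simp_all add: add_mem zero_mem)

text \<open>As both summands contain \<open>0\<close>, they are subsets of the sumset, hence finite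
  subsets of \<open>S\<close>; divisor-closedness then applies.\<close>

lemma divisor_mem:
  assumes "X + Y \<in> H" "0 \<in> X" "0 \<in> Y"
  shows "X \<in> H"
proof -
  have "X \<subseteq> X + Y" "Y \<subseteq> X + Y"
    using assms(2,3) set_plus_intro[of _ X 0 Y] set_plus_intro[of 0 X _ Y] by auto
  then have "X \<in> carrier (Pfin0 S)" "Y \<in> carrier (Pfin0 S)"
    using memD[OF assms(1)] assms(2,3) by (auto simp: Pfin0_simps intro: finite_subset)
  then have "X divides\<^bsub>Pfin0 S\<^esub> (X + Y)"
    by (auto simp: factor_def Pfin0_simps)
  with \<open>X \<in> carrier (Pfin0 S)\<close> assms(1) H show ?thesis
    by (auto simp: divisor_closed_submonoid_def)
qed

text \<open>For a nontrivial \<open>A\<close> in \<open>H\<close> with maximum \<open>a\<close>, the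
  set \<open>{0, a}\<close> divides the \<open>a\<close>-fold multiple of \<open>A\<close>.\<close>

lemma obtain_two_point:
  obtains a where "a > 0" "{0, a} \<in> H"
proof -
  obtain A where A: "A \<in> H" "A \<noteq> {0}"
    using nontrivial zero_mem by auto
  define a where "a = Max A"
  have fin: "finite A" "0 \<in> A"
    using memD A by auto
  then have max: "a \<in> A" "\<And>x. x \<in> A \<Longrightarrow> x \<le> a"
    unfolding a_def using Max_in by auto
  have "a > 0"
    using A(2) fin max by (metis gr0I le_zero_eq subset_singletonD subsetI singletonI empty_iff)
  have "{0, a} + (\<Sum>i<a - 1. A) \<in> H"
    using multiple_eq_two_point_plus[OF fin(2) max \<open>a > 0\<close>] sum_mem[OF A(1), of a] by simp
  moreover have "0 \<in> (\<Sum>i<a - 1. A)"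
    using memD sum_mem[OF A(1)] by blast
  ultimately have "{0, a} \<in> H"
    using divisor_mem[of "{0, a}"] by simp
  with \<open>a > 0\<close> that show thesis
    by blast
qed

text \<open>A general \<open>N\<close> serves both \<open>H\<close> and the divisor closure of one
  of its elements.\<close>

lemma Units_eq:
  assumes "N \<subseteq> H" "{0} \<in> N"
  shows "Units ((Pfin0 S)\<lparr>carrier := N\<rparr>) = {{0}}"
proof -
  have "{0} + {0} = {0 :: nat}"
    by simp
  then show ?thesis
    using assms by (auto simp: Units_def Pfin0_simps dest: sumset_eq_zeroD)
qed

context
  fixes a :: nat
  assumes a: "a > 0" "{0, a} \<in> H"
begin

lemma scaled_interval_mem: "(*) a ` {..n} \<in> H"
  using sum_mem[OF a(2)] by (simp add: sum_two_point)

lemma scaled_end_points_sumset: "{0, a * n} + (*) a ` {..n} = (*) a ` {..n + n}"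
  using image_mult_sumset[of a "{0, n}" "{..n}"] by (simp add: end_points_sumset)

lemma end_points_mem: "{0, a * n} \<in> H"
  using scaled_interval_mem[of "n + n"] divisor_mem[of "{0, a * n}" "(*) a ` {..n}"]
  by (force simp: scaled_end_points_sumset)

section \<open>Failure of torsion-freeness\<close>

lemma not_torsion_free: "\<not> torsion_free M"
proof
  assume tf: "torsion_free M"
  \<comment> \<open>\<open>C\<close> omits \<open>2\<close> from \<open>{..4}\<close> but has the
    same double \<open>{..8}\<close>. Scaled by \<open>a\<close>, it divides an element of
    \<open>H\<close> and so lies in \<open>H\<close>.\<close>
  define C where "C = {0, 1, 3, 4 :: nat}"
  have "C + C = {..8}"
    by (simp add: C_def set_plus_def set_eq_iff) presburger
  then have eq: "(*) a ` C + (*) a ` C = (*) a ` {..4} + (*) a ` {..4}"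
    by (simp flip: image_mult_sumset add: interval_sumset)
  moreover have "0 \<in> (*) a ` C"
    by (auto simp: C_def)
  ultimately have "(*) a ` C \<in> H"
    using add_mem[OF scaled_interval_mem scaled_interval_mem] by (metis divisor_mem)
  moreover have "(*) a ` C [^]\<^bsub>M\<^esub> (2 :: nat) = (*) a ` {..4} [^]\<^bsub>M\<^esub> (2 :: nat)"
    using eq by (simp only: pow_Pfin0) (simp add: numeral_2_eq_2)
  ultimately have "(*) a ` C = (*) a ` {..4}"
    using tf[unfolded torsion_free_def, rule_format, of _ _ 2] scaled_interval_mem[of 4] by simp
  then have "2 \<in> C"
    using a(1) by (simp add: inj_image_eq_iff inj_on_def)
  then show False
    by (simp add: C_def)
qed

section \<open>Failure of local finite generation\<close>

lemma not_locally_finitely_generated: "\<not> locally_finitely_generated M"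
proof
  assume lfg: "locally_finitely_generated M"
  define D where "D = divisor_closure M {0, a}"
  define R where "R = reduced_monoid ((Pfin0 S)\<lparr>carrier := D\<rparr>)"
  have atoms: "{0, a * n} \<in> D" for n
  proof -
    have "{0, a * n} divides\<^bsub>M\<^esub> ({0, a} [^]\<^bsub>M\<^esub> (n + n))"
      using scaled_interval_mem[of n] scaled_end_points_sumset[of n]
      unfolding pow_Pfin0 sum_two_point factor_def by (auto simp: Pfin0_simps)
    then show ?thesis
      using end_points_mem[of n] unfolding D_def divisor_closure_def by auto
  qed
  have D: "D \<subseteq> H" "{0} \<in> D"
    using atoms[of 0] by (auto simp: D_def divisor_closure_def)
  \<comment> \<open>The only unit is \<open>{0}\<close>, so each coset is a singleton
    \<open>{X}\<close> and \<open>R\<close> is a copy of \<open>D\<close>.\<close>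
  have carrier: "carrier R = (\<lambda>X. {X}) ` D"
    by (simp add: R_def reduced_monoid_def Units_eq[OF D] l_coset_def Pfin0_simps)
  have mult: "{X} \<otimes>\<^bsub>R\<^esub> {Y} = {X + Y}" for X Y
    by (simp add: R_def reduced_monoid_def set_mult_def Pfin0_simps)
  have one: "\<one>\<^bsub>R\<^esub> = {{0}}"
    by (simp add: R_def reduced_monoid_def Units_eq[OF D])
  have "finitely_generated_monoid R"
    using lfg a(2) by (simp add: locally_finitely_generated_def R_def D_def)
  then obtain E where E: "finite E" "E \<subseteq> carrier R"
      "carrier R = \<Inter> {N. submonoid N R \<and> E \<subseteq> N}"
    by (auto simp: finitely_generated_monoid_def)
  \<comment> \<open>\<open>Suc n\<close> excludes the identity \<open>{0}\<close>, leaving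
    infinitely many distinct atoms.\<close>
  have "inj (\<lambda>n. {{0, a * Suc n}})"
    using a(1) by (auto simp: inj_on_def doubleton_eq_iff)
  then have "infinite (range (\<lambda>n. {{0, a * Suc n}}))"
    by (simp add: finite_image_iff)
  then have "\<not> range (\<lambda>n. {{0, a * Suc n}}) \<subseteq> E"
    using E(1) finite_subset by blast
  then obtain n where n: "{{0, a * Suc n}} \<notin> E"
    by blast
  define N where "N = carrier R - {{{0, a * Suc n}}}"
  \<comment> \<open>Omitting an atom from a reduced monoid leaves a submonoid, so \<open>E\<close> contains every atom.\<close>
  have "submonoid N R"
  proof
    show "N \<subseteq> carrier R"
      by (auto simp: N_def)
    show "\<one>\<^bsub>R\<^esub> \<in> N"
      using D(2) a(1) by (auto simp: N_def carrier one)
    fix x y assume xy: "x \<in> N" "y \<in> N"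
    then obtain X Y where XY: "x = {X}" "y = {Y}" "X \<in> D" "Y \<in> D"
      by (auto simp: N_def carrier)
    have "X + Y \<noteq> {0, a * Suc n}"
    proof
      assume eq: "X + Y = {0, a * Suc n}"
      then have "X = {0} \<or> Y = {0}"
        using two_point_sumset XY(3,4) D(1) memD by blast
      then have "Y = {0, a * Suc n} \<or> X = {0, a * Suc n}"
        using eq by auto
      then show False
        using xy XY by (auto simp: N_def)
    qed
    \<comment> \<open>Divisors of the \<open>k\<close>-fold and \<open>l\<close>-fold multiples of
      \<open>{0, a}\<close> add up to a divisor of the \<open>(k + l)\<close>-fold one.\<close>
    moreover have "X + Y \<in> D"
    proof -
      obtain k :: nat and U where U: "U \<in> H" "(\<Sum>i<k. {0, a}) = X + U"
        using XY(3) unfolding D_def divisor_closure_def factor_def pow_Pfin0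
        by (auto simp: Pfin0_simps)
      obtain l :: nat and V where V: "V \<in> H" "(\<Sum>i<l. {0, a}) = Y + V"
        using XY(4) unfolding D_def divisor_closure_def factor_def pow_Pfin0
        by (auto simp: Pfin0_simps)
      have "(\<Sum>i<k + l. {0, a}) = (\<Sum>i<k. {0, a}) + (\<Sum>i<l. {0, a})"
        by (simp only: sum_two_point image_mult_sumset[symmetric] interval_sumset)
      also have "\<dots> = (X + Y) + (U + V)"
        unfolding U(2) V(2) by (simp only: add_ac)
      finally have "(\<Sum>i<k + l. {0, a}) = (X + Y) + (U + V)" .
      then have "(X + Y) divides\<^bsub>M\<^esub> ({0, a} [^]\<^bsub>M\<^esub> (k + l))"
        using add_mem[OF U(1) V(1)] unfolding pow_Pfin0 factor_def by (auto simp: Pfin0_simps)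
      moreover have "X + Y \<in> H"
        using add_mem XY(3,4) D(1) by blast
      ultimately show ?thesis
        unfolding D_def divisor_closure_def by auto
    qed
    ultimately show "x \<otimes>\<^bsub>R\<^esub> y \<in> N"
      by (simp add: XY mult N_def carrier)
  qed
  moreover have "E \<subseteq> N"
    using E(2) n by (auto simp: N_def)
  ultimately have "carrier R \<subseteq> N"
    using E(3) by blast
  then show False
    using atoms[of "Suc n"] by (auto simp: N_def carrier)
qed

section \<open>Transfer homomorphisms to cancellative monoids\<close>

lemma no_transfer_hom:
  assumes B: "comm_monoid_cancel B"
  shows "\<not> transfer_hom M B \<phi>"
proof
  assume "transfer_hom M B \<phi>"
  then have hom: "\<phi> \<in> hom M B" "\<phi> {0} = \<one>\<^bsub>B\<^esub>"
    and units: "{u \<in> H. \<phi> u \<in> Units B} = {{0}}"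
    and lift: "\<And>u b c. u \<in> H \<Longrightarrow> b \<in> carrier B \<Longrightarrow> c \<in> carrier B \<Longrightarrow> \<phi> u = b \<otimes>\<^bsub>B\<^esub> c \<Longrightarrow>
      \<exists>v\<in>H. \<exists>w\<in>H. u = v + w \<and> \<phi> v \<in> b <#\<^bsub>B\<^esub> Units B \<and> \<phi> w \<in> c <#\<^bsub>B\<^esub> Units B"
    using Units_eq[of H] zero_mem by (simp_all add: transfer_hom_def Pfin0_simps)
  interpret comm_monoid_cancel B
    by fact
  have in_B: "\<phi> X \<in> carrier B" if "X \<in> H" for X
    using hom(1) that by (auto simp: hom_def)
  have add: "\<phi> (X + Y) = \<phi> X \<otimes>\<^bsub>B\<^esub> \<phi> Y" if "X \<in> H" "Y \<in> H" for X Y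
    using hom(1) that by (simp add: hom_def Pfin0_simps)
  define J where "J = {0, a}"
  have J: "J \<in> H" "\<phi> J \<in> carrier B"
    using a(2) in_B by (auto simp: J_def)
  have "{0, 2} + {0, 1} = {..3 :: nat}"
    by (simp add: set_plus_def set_eq_iff) presburger
  then have "{0, a * 2} + J = (*) a ` {..3}"
    using image_mult_sumset[of a "{0, 2}" "{0, 1}"] by (simp add: J_def)
  also have "\<dots> = (J + J) + J"
    by (simp add: J_def eval_nat_numeral flip: sum_two_point add.assoc)
  finally have "{0, a * 2} + J = (J + J) + J" .
  then have "\<phi> {0, a * 2} \<otimes>\<^bsub>B\<^esub> \<phi> J = (\<phi> J \<otimes>\<^bsub>B\<^esub> \<phi> J) \<otimes>\<^bsub>B\<^esub> \<phi> J"
    using end_points_mem[of 2] J(1) by (metis add add_mem)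
  \<comment> \<open>Cancellativity of \<open>B\<close> removes the common factor, although
    \<open>{0, a * 2}\<close> and \<open>J + J\<close> differ in \<open>H\<close>.\<close>
  then have "\<phi> {0, a * 2} = \<phi> J \<otimes>\<^bsub>B\<^esub> \<phi> J"
    using J(2) in_B[OF end_points_mem] by (meson m_closed r_cancel)
  then obtain v w where vw: "v \<in> H" "w \<in> H" "{0, a * 2} = v + w"
      "\<phi> v \<in> \<phi> J <#\<^bsub>B\<^esub> Units B" "\<phi> w \<in> \<phi> J <#\<^bsub>B\<^esub> Units B"
    using lift[OF end_points_mem J(2) J(2)] by blast
  then have "v = {0} \<or> w = {0}"
    using two_point_sumset[of v w "a * 2"] memD by auto
  \<comment> \<open>The trivial summand has image the identity, yet its image is associated with
    that of \<open>J\<close>. Hence \<open>J\<close> maps to a unit and must itself be a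
    unit.\<close>
  then have "\<one>\<^bsub>B\<^esub> \<in> \<phi> J <#\<^bsub>B\<^esub> Units B"
    using vw(4,5) hom(2) by auto
  then obtain u where "u \<in> Units B" "\<phi> J \<otimes>\<^bsub>B\<^esub> u = \<one>\<^bsub>B\<^esub>"
    by (auto simp: l_coset_def)
  then have "\<phi> J \<in> Units B"
    using unit_factor[of "\<phi> J" u] J(2) Units_closed by simp
  then have "J = {0}"
    using units J(1) by auto
  then show False
    using a(1) by (auto simp: J_def)
qed

end

end

theorem theorem4p6:
  fixes S :: "nat set" and H :: "nat set set"
  assumes "numerical_monoid S"
    and "divisor_closed_submonoid H (Pfin0 S)"
    and "H \<noteq> {{0}}"
  shows "\<not> torsion_free ((Pfin0 S)\<lparr>carrier := H\<rparr>) \<and>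
    \<not> locally_finitely_generated ((Pfin0 S)\<lparr>carrier := H\<rparr>) \<and>
    (\<forall>B :: 'b monoid. comm_monoid_cancel B \<longrightarrow>
       \<not> (\<exists>\<phi>. transfer_hom ((Pfin0 S)\<lparr>carrier := H\<rparr>) B \<phi>)) \<and>
    \<not> transfer_krull TYPE('b) ((Pfin0 S)\<lparr>carrier := H\<rparr>)"
proof -
  interpret divisor_closed_power_monoid S H
    using assms by unfold_locales
  obtain a where a: "a > 0" "{0, a} \<in> H"
    by (rule obtain_two_point)
  \<comment> \<open>Krull monoids are cancellative by definition.\<close>
  have "\<not> transfer_krull TYPE('b) M"
    using no_transfer_hom[OF a] by (auto simp: transfer_krull_def krull_monoid_def)
  then show ?thesis
    using not_torsion_free[OF a] not_locally_finitely_generated[OF a] no_transfer_hom[OF a]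
    by blast
qed

end
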